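(* Let $S,T$ be nonempty subsets of $[n-1]$ such that $A=T_n\langle S;T\rangle$ is a walk-ensured Toeplitz matrix, let $d=\gcd(S\cup T)$, and let $B$ be an $n\times n$ Boolean matrix with $A\le B$ (entrywise). If the digraph $D(B-A)/\mathbb{Z}_d$ has a source or a sink, then $A$ and $B$ have the same matrix period.
   Context: Matrices are Boolean ($0,1$ entries with $1+1=1$), and powers are Boolean matrix powers. For nonempty $S,T\subseteq[n-1]$, $T_n\langle S;T\rangle$ denotes the $n\times n$ $(0,1)$-matrix whose $(i,j)$-entry is $1$ if and only if $j-i\in S$ or $i-j\in T$. For an $n\times n$ Boolean matrix $C$, its digraph $D(C)$ has vertex set $[n]$ and an arc $(i,j)$ exactly when the $(i,j)$-entry of $C$ is $1$. For $A\le B$, $B-A$ is the $(0,1)$-matrix having $1$ exactly in the positions where $B$ has $1$ and $A$ has $0$. $\gcd(S\cup T)$ is the gcd of all elements of $S\cup T$; $\gcd(S+T)=\gcd\{s+t: s\in S,t\in T\}$; $s_1=\min S$. The matrix $A$ is called walk-ensured if there is a positive integer $M$ such that for all vertices $u,v\in[n]$ and every integer $\ell\ge M$ with $v-u\equiv \ell s_1 \pmod{\gcd(S+T)}$, there is a directed walk from $u$ to $v$ of length $\ell$ in $D(A)$. The matrix period of a Boolean square matrix $A$ is the smallest positive integer $p$ for which there is $M$ with $A^m=A^{m+p}$ for all $m\ge M$. For a digraph $D$ on $[n]$ and a positive integer $d$, $D/\mathbb{Z}_d$ is the digraph on $\{1,\ldots,d\}$ (obtained by contracting each residue class mod $d$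 to its representative in $\{1,\ldots,d\}$) with an arc $(i,j)$ (loops allowed) if and only if $D$ has an arc $(m,l)$ with $m\equiv i$ and $l\equiv j \pmod d$. A source is a vertex with no incoming arcs and a sink is a vertex with no outgoing arcs. *)

theory Defs
  imports
    "Jordan_Normal_Form.Matrix"
    "Graph_Theory.Pair_Digraph"
    "HOL-Number_Theory.Cong"
begin

text \<open>
  The Boolean semiring. The order and the difference on \<^typ>\<open>bool\<close> are those of the library, so
  that on Boolean matrices \<open>A \<le> B\<close> is the entrywise order and \<open>B - A\<close> has the entry 1 exactly
  where \<open>B\<close> has 1 and \<open>A\<close> has 0.
\<close>

instantiation bool :: comm_semiring_1
begin

definition zero_bool :: bool where "0 = False"
definition one_bool :: bool where "1 = True"
definition plus_bool :: "bool \<Rightarrow> bool \<Rightarrow> bool" where "x + y = (x \<or> y)"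
definition times_bool :: "bool \<Rightarrow> bool \<Rightarrow> bool" where "x * y = (x \<and> y)"

instance
  by standard (auto simp: zero_bool_def one_bool_def plus_bool_def times_bool_def)

end

text \<open>The entry depends only on \<open>j - i\<close>, so 0-based matrix indices may be used directly.\<close>

definition toeplitz :: "nat \<Rightarrow> nat set \<Rightarrow> nat set \<Rightarrow> bool mat" where
  "toeplitz n S T = mat n n (\<lambda>(i, j). int j - int i \<in> int ` S \<or> int i - int j \<in> int ` T)"

text \<open>Vertices are \<open>1, \<dots>, n\<close>, whereas matrix indices are 0-based.\<close>

definition digraph_of :: "bool mat \<Rightarrow> nat pair_pre_digraph" where
  "digraph_of C =
    \<lparr> pverts = {1..dim_row C},
      parcs = {(i + 1, j + 1) | i j. i < dim_row C \<and> j < dim_col C \<and> C $$ (i, j) = 1} \<rparr>"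

definition walk_ensured :: "nat \<Rightarrow> nat set \<Rightarrow> nat set \<Rightarrow> bool" where
  "walk_ensured n S T \<longleftrightarrow>
    (\<exists>M>0. \<forall>u\<in>{1..n}. \<forall>v\<in>{1..n}. \<forall>l\<ge>M.
      [int v - int u = int l * int (Min S)] (mod int (Gcd {s + t | s t. s \<in> S \<and> t \<in> T})) \<longrightarrow>
      (\<exists>p. pre_digraph.awalk (with_proj (digraph_of (toeplitz n S T))) u p v \<and> length p = l))"

definition matrix_period :: "bool mat \<Rightarrow> nat" where
  "matrix_period A = (LEAST p. 0 < p \<and> (\<exists>M. \<forall>m\<ge>M. A ^\<^sub>m m = A ^\<^sub>m (m + p)))"

definition residue_contraction :: "nat pair_pre_digraph \<Rightarrow> nat \<Rightarrow> nat pair_pre_digraph" where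
  "residue_contraction D d =
    \<lparr> pverts = {1..d},
      parcs = {(i, j). i \<in> {1..d} \<and> j \<in> {1..d} \<and>
        (\<exists>(m, l)\<in>parcs D. [m = i] (mod d) \<and> [l = j] (mod d))} \<rparr>"

definition has_source :: "nat pair_pre_digraph \<Rightarrow> bool" where
  "has_source D \<longleftrightarrow> (\<exists>v\<in>pverts D. in_arcs (with_proj D) v = {})"

definition has_sink :: "nat pair_pre_digraph \<Rightarrow> bool" where
  "has_sink D \<longleftrightarrow> (\<exists>v\<in>pverts D. out_arcs (with_proj D) v = {})"

end

theory Submission
  imports Defs
begin

text \<open>
  Put \<open>g = gcd (S + T)\<close> and \<open>q = g / d\<close>. Every arc of \<open>D(A)\<close> shifts the vertex by \<open>min S\<close> modulo \<open>g\<close>,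
  and \<open>gcd (g, min S) = d\<close>, so closed walks of \<open>D(A)\<close> have length divisible by \<open>q\<close>; by walk-ensuredness
  every vertex conversely lies on closed walks of all large lengths divisible by \<open>q\<close>.
  A long walk in \<open>D(B)\<close> contains a long closed subwalk of length divisible by \<open>q\<close>, which can be
  exchanged for a closed walk of \<open>D(A)\<close> that is longer by \<open>q\<close>; hence \<open>B\<^sup>m \<le> B\<^bsup>m+q\<^esup>\<close> for large \<open>m\<close>, and
  the period of \<open>B\<close> is at most \<open>q\<close>. If a residue class modulo \<open>d\<close> is a source or a sink of the
  contraction of \<open>D(B - A)\<close>, then walks in \<open>D(B)\<close> from a vertex of this class to itself are
  walks in \<open>D(A)\<close>, because arcs of \<open>D(A)\<close> preserve the classes. This forces the period to be at least \<open>q\<close>.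
\<close>

section \<open>Periods of relation powers\<close>

lemma relpow_subset_Times:
  assumes "R \<subseteq> V \<times> V" and "0 < m"
  shows "R ^^ m \<subseteq> V \<times> V"
proof -
  obtain k where "m = Suc k"
    using assms(2) gr0_implies_Suc by blast
  have "R ^^ Suc k \<subseteq> V \<times> V" for k
    by (induction k) (use assms(1) in auto)
  then show ?thesis
    using \<open>m = Suc k\<close> by blast
qed

lemma relpow_path_segment:
  assumes "\<forall>i<m. (f i, f (Suc i)) \<in> R" and "i + k \<le> m"
  shows "(f i, f (i + k)) \<in> R ^^ k"
  using assms(2) by (induction k) (use assms(1) in auto)

lemma relpow_addI: "(x, y) \<in> R ^^ i \<Longrightarrow> (y, z) \<in> R ^^ j \<Longrightarrow> (x, z) \<in> R ^^ (i + j)"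
  by (auto simp: relpow_add)

text \<open>A walk that starts in \<open>P\<close> can never leave it, so each of its arcs lies in
  \<open>Q\<close>. With \<open>P\<close> a residue class this confines walks of \<open>B\<close> to
  arcs of \<open>A\<close>; with \<open>P = UNIV\<close> it is monotonicity of powers.\<close>

lemma relpow_mono_on_closed:
  assumes "\<And>x y. (x, y) \<in> R \<Longrightarrow> x \<in> P \<Longrightarrow> (x, y) \<in> Q \<and> y \<in> P"
    and "(x, y) \<in> R ^^ m" and "x \<in> P"
  shows "(x, y) \<in> Q ^^ m \<and> y \<in> P"
  using assms(2) by (induction m arbitrary: y) (use assms(1,3) in \<open>auto intro!: relcompI\<close>)

lemma converse_relpow: "(R\<inverse>) ^^ m = (R ^^ m)\<inverse>" for R :: "'a rel"
  by (induction m) (auto simp: converse_relcomp relpow_commute[symmetric])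

text \<open>Pigeonhole on the \<open>card V + 1\<close> points visited at times
  \<open>0, K, ..., card V * K\<close>: two coincide, and the closed piece between them is exchanged
  for one longer by \<open>q\<close>.\<close>

lemma relpow_subset_add_period:
  assumes "finite V" and "R \<subseteq> V \<times> V" and "0 < q" and "0 < M"
    and closed: "\<And>v l. v \<in> V \<Longrightarrow> M \<le> l \<Longrightarrow> q dvd l \<Longrightarrow> (v, v) \<in> R ^^ l"
    and "card V * (q * M) < m"
  shows "R ^^ m \<subseteq> R ^^ (m + q)"
proof
  fix e assume "e \<in> R ^^ m"
  then obtain u v where e: "e = (u, v)" and "(u, v) \<in> R ^^ m"
    by (cases e) auto
  then obtain f where f: "f 0 = u" "f m = v" "\<forall>i<m. (f i, f (Suc i)) \<in> R"
    by (auto simp: relpow_fun_conv)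
  \<comment> \<open>The factor \<open>q\<close> makes the time between any two samples divisible by
    \<open>q\<close>; the factor \<open>M\<close> makes it long enough for
    \<open>closed\<close>.\<close>
  define K where "K = q * M"
  have K: "card V * K < m"
    using assms(6) by (simp add: K_def)
  \<comment> \<open>Strictness matters: every sampled point is then the tail of an arc of the walk,
    which places it in \<open>V\<close>.\<close>
  have below: "j * K < m" if "j \<le> card V" for j
    using mult_le_mono1[OF that, of K] K by linarith
  have "(\<lambda>j. f (j * K)) ` {..card V} \<subseteq> V"
  proof (rule image_subsetI)
    fix j assume "j \<in> {..card V}"
    then have "(f (j * K), f (Suc (j * K))) \<in> R"
      using f(3) below by simp
    then show "f (j * K) \<in> V"
      using assms(2) by blast
  qed
  from card_mono[OF assms(1) this] have "card ((\<lambda>j. f (j * K)) ` {..card V}) < card {..card V}"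
    by simp
  from pigeonhole[OF this] have "\<not> inj_on (\<lambda>j. f (j * K)) {..card V}" .
  then have "\<exists>a b. a < b \<and> b \<le> card V \<and> f (a * K) = f (b * K)"
    by (auto intro!: linorder_inj_onI)
  then obtain a b where ab: "a < b" "b \<le> card V" "f (a * K) = f (b * K)"
    by blast
  define w where "w = f (a * K)"
  have "w \<in> V"
    using \<open>_ ` _ \<subseteq> V\<close> ab unfolding w_def by auto
  have bK: "b * K = a * K + (b - a) * K"
    using ab(1) by (simp flip: distrib_right)
  have "(u, w) \<in> R ^^ (a * K)"
    using relpow_path_segment[OF f(3), of 0 "a * K"] below[of a] ab f(1) by (simp add: w_def)
  moreover have "(w, v) \<in> R ^^ (m - b * K)"
    using relpow_path_segment[OF f(3), of "b * K" "m - b * K"] below[OF ab(2)] ab f(2)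
    by (simp add: w_def)
  moreover have "(w, w) \<in> R ^^ ((b - a) * K + q)"
  proof (rule closed[OF \<open>w \<in> V\<close>])
    have "1 * M \<le> (b - a) * q * M"
      using ab(1) assms(3) by (intro mult_le_mono1) (simp add: Suc_le_eq)
    then have "1 * M \<le> (b - a) * K"
      by (simp only: K_def mult.assoc)
    then show "M \<le> (b - a) * K + q"
      by linarith
  qed (simp add: K_def)
  ultimately have "(u, v) \<in> R ^^ (a * K + ((b - a) * K + q) + (m - b * K))"
    by (blast intro: relpow_addI)
  moreover have "a * K + ((b - a) * K + q) + (m - b * K) = m + q"
    using bK below[OF ab(2)] by simp
  ultimately show "e \<in> R ^^ (m + q)"
    by (simp add: e)
qed

text \<open>Along steps of \<open>q\<close> the powers form an increasing chain of subsets of a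
  finite set, so two neighbours agree. Composing that one equality with \<open>R ^^ k\<close>
  carries it to all larger exponents, in every residue class modulo \<open>q\<close>.\<close>

lemma relpow_eventually_periodic:
  assumes "finite V" and "R \<subseteq> V \<times> V"
    and incr: "\<And>m. N < m \<Longrightarrow> R ^^ m \<subseteq> R ^^ (m + q)"
  shows "\<exists>M. \<forall>m\<ge>M. R ^^ m = R ^^ (m + q)"
proof -
  define F where "F i = R ^^ (Suc N + i * q)" for i
  have "F i \<subseteq> F (Suc i)" for i
    using incr[of "Suc N + i * q"] by (simp add: F_def add_ac)
  then have F_mono: "F i \<subseteq> F j" if "i \<le> j" for i j
    using that by (rule lift_Suc_mono_le)
  have "range F \<subseteq> Pow (V \<times> V)"
    using relpow_subset_Times[OF assms(2)] unfolding F_def by blast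
  then have "finite (range F)"
    using assms(1) by (meson finite_Pow_iff finite_SigmaI finite_subset)
  then have "\<not> inj F"
    using finite_imageD infinite_UNIV_nat by blast
  then have "\<exists>a b. a < b \<and> F a = F b"
    by (auto intro!: linorder_inj_onI)
  then obtain a b where "a < b" "F a = F b"
    by blast
  then have "F a = F (Suc a)"
    using F_mono[of a "Suc a"] F_mono[of "Suc a" b] by auto
  then have eq: "R ^^ (Suc N + a * q) = R ^^ (Suc N + a * q + q)"
    by (simp add: F_def add_ac)
  have "R ^^ m = R ^^ (m + q)" if "Suc N + a * q \<le> m" for m
  proof -
    from le_Suc_ex[OF that] obtain k where k: "m = Suc N + a * q + k" ..
    have "R ^^ m = R ^^ (Suc N + a * q) O R ^^ k"
      unfolding k by (rule relpow_add)
    also have "\<dots> = R ^^ (Suc N + a * q + q) O R ^^ k"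
      by (subst eq) (rule refl)
    also have "\<dots> = R ^^ (Suc N + a * q + q + k)"
      by (rule relpow_add[symmetric])
    also have "Suc N + a * q + q + k = m + q"
      by (simp add: k)
    finally show ?thesis .
  qed
  then show ?thesis
    by blast
qed

text \<open>Closed walks at all vertices make \<open>q\<close> a period; the divisibility condition
  at the single vertex \<open>r\<close> excludes every smaller one.\<close>

lemma relpow_period_eq:
  assumes "finite V" and "R \<subseteq> V \<times> V" and "0 < q" and "0 < M"
    and closed: "\<And>v l. v \<in> V \<Longrightarrow> M \<le> l \<Longrightarrow> q dvd l \<Longrightarrow> (v, v) \<in> R ^^ l"
    and "r \<in> V" and r: "\<And>l. (r, r) \<in> R ^^ l \<Longrightarrow> q dvd l"
  shows "(LEAST p. 0 < p \<and> (\<exists>M. \<forall>m\<ge>M. R ^^ m = R ^^ (m + p))) = q"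
proof (rule Least_equality)
  have "R ^^ m \<subseteq> R ^^ (m + q)" if "card V * (q * M) < m" for m
    using relpow_subset_add_period[OF assms(1-4) closed that] .
  from relpow_eventually_periodic[OF assms(1,2) this]
  show "0 < q \<and> (\<exists>M. \<forall>m\<ge>M. R ^^ m = R ^^ (m + q))"
    using assms(3) by simp
next
  fix p assume p: "0 < p \<and> (\<exists>M. \<forall>m\<ge>M. R ^^ m = R ^^ (m + p))"
  then obtain M' where M': "\<And>m. M' \<le> m \<Longrightarrow> R ^^ m = R ^^ (m + p)"
    by blast
  \<comment> \<open>A multiple of \<open>q\<close> beyond both thresholds: \<open>r\<close> has a
    closed walk of length \<open>m\<close>, hence one of length \<open>m + p\<close>.\<close>
  define m where "m = q * (M + M')"
  have m: "M \<le> m" "M' \<le> m"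
    using assms(3) unfolding m_def by (cases q; simp)+
  have "(r, r) \<in> R ^^ (m + p)"
    using closed[OF \<open>r \<in> V\<close> m(1)] M'[OF m(2)] by (simp add: m_def)
  then have "q dvd m + p"
    by (rule r)
  then have "q dvd p"
    by (simp add: m_def dvd_add_right_iff)
  then show "q \<le> p"
    using p by (simp add: dvd_imp_le)
qed

section \<open>Boolean matrices as relations\<close>

text \<open>The arc set of the digraph of \<open>C\<close> in 0-based indices, so that Boolean
  matrix powers become relation powers.\<close>

definition support_rel :: "bool mat \<Rightarrow> nat rel" where
  "support_rel C = {(i, j). i < dim_row C \<and> j < dim_col C \<and> C $$ (i, j)}"

lemma sum_bool_iff: "finite I \<Longrightarrow> sum f I \<longleftrightarrow> (\<exists>i\<in>I. f i)" for f :: "'a \<Rightarrow> bool"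
  by (induction I rule: finite_induct) (auto simp: zero_bool_def plus_bool_def)

lemma pow_mat_bool_iff:
  assumes C: "C \<in> carrier_mat n n" and "i < n" and "j < n"
  shows "(C ^\<^sub>m m) $$ (i, j) \<longleftrightarrow> (i, j) \<in> support_rel C ^^ m"
  using assms(3)
proof (induction m arbitrary: j)
  case 0
  then show ?case
    using C \<open>i < n\<close> by (auto simp: zero_bool_def one_bool_def)
next
  case (Suc m)
  have "(C ^\<^sub>m Suc m) $$ (i, j) = (\<Sum>k<n. (C ^\<^sub>m m) $$ (i, k) * C $$ (k, j))"
    using C \<open>i < n\<close> Suc.prems pow_carrier_mat[OF C, of m]
    by (simp add: scalar_prod_def atLeast0LessThan)
  also have "\<dots> \<longleftrightarrow> (\<exists>k<n. (i, k) \<in> support_rel C ^^ m \<and> C $$ (k, j))"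
    using Suc.IH by (auto simp: sum_bool_iff times_bool_def)
  also have "\<dots> \<longleftrightarrow> (i, j) \<in> support_rel C ^^ Suc m"
    using C Suc.prems by (auto simp: support_rel_def)
  finally show ?case .
qed

lemma matrix_period_eq_relpow:
  assumes C: "C \<in> carrier_mat n n"
  shows "matrix_period C =
    (LEAST p. 0 < p \<and> (\<exists>M. \<forall>m\<ge>M. support_rel C ^^ m = support_rel C ^^ (m + p)))"
proof -
  \<comment> \<open>Exponent 0 is excluded because \<open>R ^^ 0\<close> is the identity on all
    naturals, not only below \<open>n\<close>. Periods concern large exponents only, so raising the
    threshold from \<open>M\<close> to \<open>Suc M\<close> below avoids it.\<close>
  have sub: "support_rel C ^^ m \<subseteq> {..<n} \<times> {..<n}" if "0 < m" for m
    using C by (intro relpow_subset_Times that) (auto simp: support_rel_def)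
  have eq_iff: "C ^\<^sub>m m = C ^\<^sub>m k \<longleftrightarrow> support_rel C ^^ m = support_rel C ^^ k"
    if "0 < m" "0 < k" for m k
  proof
    assume "C ^\<^sub>m m = C ^\<^sub>m k"
    then have "(i, j) \<in> support_rel C ^^ m \<longleftrightarrow> (i, j) \<in> support_rel C ^^ k"
      if "i < n" "j < n" for i j
      using pow_mat_bool_iff[OF C that] by metis
    then show "support_rel C ^^ m = support_rel C ^^ k"
      using sub[OF that(1)] sub[OF that(2)] by auto
  next
    assume eq: "support_rel C ^^ m = support_rel C ^^ k"
    note dims = carrier_matD[OF pow_carrier_mat[OF C]]
    show "C ^\<^sub>m m = C ^\<^sub>m k"
    proof (rule eq_matI)
      fix i j assume "i < dim_row (C ^\<^sub>m k)" and "j < dim_col (C ^\<^sub>m k)"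
      then have "i < n" and "j < n"
        unfolding dims .
      then show "(C ^\<^sub>m m) $$ (i, j) = (C ^\<^sub>m k) $$ (i, j)"
        by (simp only: pow_mat_bool_iff[OF C] eq)
    qed (simp_all only: dims)
  qed
  have "(\<exists>M. \<forall>m\<ge>M. C ^\<^sub>m m = C ^\<^sub>m (m + p)) \<longleftrightarrow>
    (\<exists>M. \<forall>m\<ge>M. support_rel C ^^ m = support_rel C ^^ (m + p))" for p
  proof
    assume "\<exists>M. \<forall>m\<ge>M. C ^\<^sub>m m = C ^\<^sub>m (m + p)"
    then obtain M where M: "\<forall>m\<ge>M. C ^\<^sub>m m = C ^\<^sub>m (m + p)" ..
    have "support_rel C ^^ m = support_rel C ^^ (m + p)" if "Suc M \<le> m" for m
      by (rule eq_iff[THEN iffD1]) (use that in simp, use that in simp, use M that Suc_leD in blast)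
    then show "\<exists>M. \<forall>m\<ge>M. support_rel C ^^ m = support_rel C ^^ (m + p)"
      by blast
  next
    assume "\<exists>M. \<forall>m\<ge>M. support_rel C ^^ m = support_rel C ^^ (m + p)"
    then obtain M where M: "\<forall>m\<ge>M. support_rel C ^^ m = support_rel C ^^ (m + p)" ..
    have "C ^\<^sub>m m = C ^\<^sub>m (m + p)" if "Suc M \<le> m" for m
      by (rule eq_iff[THEN iffD2]) (use that in simp, use that in simp, use M that Suc_leD in blast)
    then show "\<exists>M. \<forall>m\<ge>M. C ^\<^sub>m m = C ^\<^sub>m (m + p)"
      by blast
  qed
  then show ?thesis
    by (simp add: matrix_period_def)
qed

lemma parcs_digraph_of: "parcs (digraph_of C) = map_prod Suc Suc ` support_rel C"
  by (auto simp: digraph_of_def support_rel_def one_bool_def image_iff)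

lemma Suc_Suc_mem_parcs_digraph_of:
  "(Suc i, Suc j) \<in> parcs (digraph_of C) \<longleftrightarrow> (i, j) \<in> support_rel C"
  by (force simp: parcs_digraph_of)

lemma awalk_digraph_of_imp_relpow:
  assumes "pre_digraph.awalk (with_proj (digraph_of C)) u p v"
  shows "(u - 1, v - 1) \<in> support_rel C ^^ length p"
proof -
  \<comment> \<open>The induction uses only \<open>cas\<close> and the arc condition, both of which
    pass directly to the tail of the walk.\<close>
  have "(u - 1, v - 1) \<in> support_rel C ^^ length p"
    if "pre_digraph.cas (with_proj (digraph_of C)) u p v" "set p \<subseteq> parcs (digraph_of C)"
    using that
  proof (induction p arbitrary: u)
    case Nil
    then show ?case
      by (simp add: pre_digraph.cas.simps)
  next
    case (Cons e p)
    then have "(fst e - 1, snd e - 1) \<in> support_rel C" "fst e = u"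
      "(snd e - 1, v - 1) \<in> support_rel C ^^ length p"
      by (auto simp: pre_digraph.cas.simps parcs_digraph_of)
    from relpow_Suc_I2[OF this(1,3)] this(2) show ?case
      by simp
  qed
  then show ?thesis
    using assms by (simp add: pre_digraph.awalk_def)
qed

section \<open>Toeplitz matrices\<close>

lemma cong_residue_ex:
  assumes "0 < (d :: nat)"
  obtains i where "i \<in> {1..d}" and "[m = i] (mod d)"
proof (cases "m mod d = 0")
  \<comment> \<open>Residue 0 is represented by \<open>d\<close> itself.\<close>
  case True
  then show ?thesis
    using assms that[of d] by (simp add: cong_def)
next
  case False
  then show ?thesis
    using assms that[of "m mod d"] by (simp add: Suc_le_eq order_less_imp_le)
qed

text \<open>An arc of \<open>D\<close> ending in the class of \<open>v\<close> would contract to an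
  arc into \<open>v\<close>, once its tail is replaced by its representative.\<close>

lemma residue_contraction_source:
  assumes "0 < d" and "has_source (residue_contraction D d)"
  obtains v where "v \<in> {1..d}" and "\<And>m l. (m, l) \<in> parcs D \<Longrightarrow> \<not> [l = v] (mod d)"
proof -
  obtain v where v: "v \<in> {1..d}" "in_arcs (with_proj (residue_contraction D d)) v = {}"
    using assms(2) by (auto simp: has_source_def residue_contraction_def)
  have "\<not> [l = v] (mod d)" if "(m, l) \<in> parcs D" for m l
  proof
    assume "[l = v] (mod d)"
    moreover obtain i where "i \<in> {1..d}" "[m = i] (mod d)"
      using cong_residue_ex[OF assms(1)] .
    ultimately have "(i, v) \<in> in_arcs (with_proj (residue_contraction D d)) v"
      using v(1) that by (auto simp: in_arcs_def residue_contraction_def)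
    then show False
      using v(2) by simp
  qed
  then show ?thesis
    using that v(1) by blast
qed

lemma residue_contraction_sink:
  assumes "0 < d" and "has_sink (residue_contraction D d)"
  obtains v where "v \<in> {1..d}" and "\<And>m l. (m, l) \<in> parcs D \<Longrightarrow> \<not> [m = v] (mod d)"
proof -
  obtain v where v: "v \<in> {1..d}" "out_arcs (with_proj (residue_contraction D d)) v = {}"
    using assms(2) by (auto simp: has_sink_def residue_contraction_def)
  have "\<not> [m = v] (mod d)" if "(m, l) \<in> parcs D" for m l
  proof
    assume "[m = v] (mod d)"
    moreover obtain j where "j \<in> {1..d}" "[l = j] (mod d)"
      using cong_residue_ex[OF assms(1)] .
    ultimately have "(v, j) \<in> out_arcs (with_proj (residue_contraction D d)) v"
      using v(1) that by (auto simp: out_arcs_def residue_contraction_def)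
    then show False
      using v(2) by simp
  qed
  then show ?thesis
    using that v(1) by blast
qed

section \<open>Arcs and walks of Toeplitz matrices modulo the two gcds\<close>

lemma support_rel_toeplitz:
  "support_rel (toeplitz n S T) =
    {(i, j). i < n \<and> j < n \<and> (int j - int i \<in> int ` S \<or> int i - int j \<in> int ` T)}"
  by (auto simp: support_rel_def toeplitz_def)

lemma support_rel_diff:
  assumes "A \<in> carrier_mat n n" and "B \<in> carrier_mat n n"
  shows "support_rel (B - A) = support_rel B - support_rel A"
  using assms by (auto simp: support_rel_def)

lemma support_rel_mono:
  assumes "A \<le> B"
  shows "support_rel A \<subseteq> support_rel B"
  using assms by (auto simp: support_rel_def less_eq_mat_def)

lemma toeplitz_arc_cong_Gcd:
  assumes "(i, j) \<in> support_rel (toeplitz n S T)"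
  shows "[i = j] (mod Gcd (S \<union> T))"
proof -
  let ?d = "int (Gcd (S \<union> T))"
  have d: "?d dvd int x" if "x \<in> S \<union> T" for x
    using that by (metis Gcd_dvd int_dvd_int_iff)
  have "?d dvd int i - int j \<or> ?d dvd int j - int i"
    using assms d unfolding support_rel_toeplitz by fastforce
  then have "?d dvd int i - int j"
    by (simp add: dvd_diff_commute)
  then show ?thesis
    by (metis cong_iff_dvd_diff cong_int_iff)
qed

text \<open>Subtracting \<open>Min S + t\<close> from \<open>s + t\<close> cancels \<open>t\<close>.
  Hence forward arcs (by \<open>s\<close>) and backward arcs (by \<open>-t\<close>) both shift by
  \<open>Min S\<close> modulo \<open>g\<close>.\<close>

lemma Gcd_sumset_dvd_diff_Min:
  assumes "S \<noteq> {}" "finite S" "T \<noteq> {}"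
  defines "g \<equiv> int (Gcd {s + t | s t. s \<in> S \<and> t \<in> T})"
  shows "s \<in> S \<Longrightarrow> g dvd int s - int (Min S)" and "t \<in> T \<Longrightarrow> g dvd int t + int (Min S)"
proof -
  have g: "g dvd int s + int t" if "s \<in> S" "t \<in> T" for s t
    unfolding g_def of_nat_add[symmetric] int_dvd_int_iff using that by (intro Gcd_dvd) blast
  have Min: "Min S \<in> S"
    using assms by simp
  show "g dvd int t + int (Min S)" if "t \<in> T"
    using g[OF Min that] by (simp add: add.commute)
  obtain t where "t \<in> T"
    using assms by blast
  show "g dvd int s - int (Min S)" if "s \<in> S"
    using dvd_diff[OF g[OF that \<open>t \<in> T\<close>] g[OF Min \<open>t \<in> T\<close>]] by simp
qed

text \<open>Each arc adds \<open>Min S\<close> modulo the gcd of the sumset. This is the converse of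
  the implication in \<open>walk_ensured\<close>.\<close>

lemma toeplitz_relpow_cong:
  assumes "S \<noteq> {}" "finite S" "T \<noteq> {}"
    and "(u, v) \<in> support_rel (toeplitz n S T) ^^ l"
  shows "[int v - int u = int l * int (Min S)] (mod int (Gcd {s + t | s t. s \<in> S \<and> t \<in> T}))"
  using assms(4)
proof (induction l arbitrary: v)
  case (Suc l)
  let ?g = "int (Gcd {s + t | s t. s \<in> S \<and> t \<in> T})"
  from Suc.prems obtain w where
    w: "(u, w) \<in> support_rel (toeplitz n S T) ^^ l" "(w, v) \<in> support_rel (toeplitz n S T)"
    by auto
  consider s where "s \<in> S" "int v - int w = int s" | t where "t \<in> T" "int w - int v = int t"
    using w(2) unfolding support_rel_toeplitz by auto
  then have "?g dvd int v - int w - int (Min S)"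
  proof cases
    case (1 s)
    then show ?thesis
      using Gcd_sumset_dvd_diff_Min(1)[OF assms(1-3)] by simp
  next
    case (2 t)
    then have "int v - int w - int (Min S) = - (int t + int (Min S))"
      by simp
    then show ?thesis
      using Gcd_sumset_dvd_diff_Min(2)[OF assms(1-3) 2(1)] by (simp only: dvd_minus_iff)
  qed
  moreover have "?g dvd int w - int u - int l * int (Min S)"
    using Suc.IH[OF w(1)] by (simp add: cong_iff_dvd_diff)
  ultimately have "?g dvd (int v - int w - int (Min S)) + (int w - int u - int l * int (Min S))"
    by (rule dvd_add)
  then show ?case
    by (simp add: cong_iff_dvd_diff algebra_simps)
qed simp

text \<open>Modulo a common divisor of both arguments, elements of \<open>S\<close> are congruent to
  \<open>Min S\<close> and those of \<open>T\<close> to \<open>- Min S\<close>, hence all to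
  0.\<close>

lemma gcd_Gcd_sumset_Min:
  fixes S T :: "nat set"
  assumes "S \<noteq> {}" "finite S" "T \<noteq> {}"
  shows "gcd (Gcd {s + t | s t. s \<in> S \<and> t \<in> T}) (Min S) = Gcd (S \<union> T)"
    (is "gcd ?g _ = ?d")
proof (rule dvd_antisym)
  have Min: "Min S \<in> S"
    using assms by simp
  let ?c = "gcd ?g (Min S)"
  have "int ?c dvd int x" if "x \<in> S \<union> T" for x
  proof -
    have c: "int ?c dvd int ?g" "int ?c dvd int (Min S)"
      unfolding int_dvd_int_iff by simp_all
    show ?thesis
      using that
    proof
      assume "x \<in> S"
      then have "int ?c dvd int x - int (Min S)"
        using Gcd_sumset_dvd_diff_Min(1)[OF assms] c(1) dvd_trans by blast
      from dvd_add[OF this c(2)] show ?thesis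
        by simp
    next
      assume "x \<in> T"
      then have "int ?c dvd int x + int (Min S)"
        using Gcd_sumset_dvd_diff_Min(2)[OF assms] c(1) dvd_trans by blast
      from dvd_diff[OF this c(2)] show ?thesis
        by simp
    qed
  qed
  then show "?c dvd ?d"
    by (intro Gcd_greatest) (simp only: int_dvd_int_iff)
  have "?d dvd ?g"
    by (rule Gcd_greatest) (blast intro: dvd_add Gcd_dvd)
  then show "?d dvd ?c"
    using Min by (auto intro!: gcd_greatest Gcd_dvd)
qed

text \<open>After cancelling the gcd, the remaining factors of \<open>a\<close> and \<open>b\<close>
  are coprime.\<close>

lemma dvd_mult_iff_div_gcd_dvd:
  fixes a b l :: nat
  assumes "0 < a"
  shows "a dvd l * b \<longleftrightarrow> a div gcd a b dvd l"
proof -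
  define c where "c = gcd a b"
  have "0 < c"
    using assms by (simp add: c_def)
  have a: "(a div c) * c = a" and b: "(b div c) * c = b"
    by (simp_all add: c_def)
  have "a dvd l * b \<longleftrightarrow> (a div c) * c dvd (l * (b div c)) * c"
    by (simp only: mult.assoc a b)
  also have "\<dots> \<longleftrightarrow> a div c dvd l * (b div c)"
    using \<open>0 < c\<close> by simp
  also have "\<dots> \<longleftrightarrow> a div c dvd l"
    using assms unfolding c_def by (intro coprime_dvd_mult_left_iff div_gcd_coprime) simp
  finally show ?thesis
    by (simp add: c_def)
qed

theorem theorem4p3:
  fixes n :: nat and S T :: "nat set" and B :: "bool mat"
  assumes "S \<noteq> {}" and "S \<subseteq> {1..n - 1}"
    and "T \<noteq> {}" and "T \<subseteq> {1..n - 1}"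
    and "walk_ensured n S T"
    and "B \<in> carrier_mat n n"
    and "toeplitz n S T \<le> B"
    and "has_source (residue_contraction (digraph_of (B - toeplitz n S T)) (Gcd (S \<union> T))) \<or>
         has_sink (residue_contraction (digraph_of (B - toeplitz n S T)) (Gcd (S \<union> T)))"
  shows "matrix_period (toeplitz n S T) = matrix_period B"
proof -
  define A where "A = toeplitz n S T"
  define g where "g = Gcd {s + t | s t. s \<in> S \<and> t \<in> T}"
  define d where "d = Gcd (S \<union> T)"
  define q where "q = g div d"
  define V where "V = {..<n}"
  have "finite S"
    using assms(2) finite_subset by blast
  have A: "A \<in> carrier_mat n n"
    by (simp add: A_def toeplitz_def)
  have "Min S \<in> S"
    using assms(1) \<open>finite S\<close> by simp
  have "d dvd Min S"
    unfolding d_def using \<open>Min S \<in> S\<close> by (intro Gcd_dvd) simp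
  \<comment> \<open>The resulting \<open>d < n\<close> ensures that every class representative in
    \<open>{1..d}\<close> is a vertex of the original digraph.\<close>
  moreover have "0 < Min S" "Min S < n"
    using assms(2) \<open>Min S \<in> S\<close> by fastforce+
  ultimately have "0 < d" "d < n"
    by (auto dest: dvd_imp_le intro: Nat.gr0I)
  obtain t where "t \<in> T"
    using assms(3) by blast
  have "g dvd Min S + t"
    unfolding g_def using \<open>Min S \<in> S\<close> \<open>t \<in> T\<close> by (intro Gcd_dvd) blast
  then have "0 < g"
    using \<open>0 < Min S\<close> by (intro Nat.gr0I) simp
  have gcd: "gcd g (Min S) = d"
    unfolding g_def d_def by (rule gcd_Gcd_sumset_Min[OF assms(1) \<open>finite S\<close> assms(3)])
  \<comment> \<open>For \<open>u = v\<close> the congruence in \<open>walk_ensured\<close> says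
    \<open>g dvd l * Min S\<close>, so this makes \<open>q\<close> the modulus for lengths of closed
    walks.\<close>
  have q: "g dvd l * Min S \<longleftrightarrow> q dvd l" for l
    using dvd_mult_iff_div_gcd_dvd[OF \<open>0 < g\<close>, of l "Min S"] by (simp add: gcd q_def)
  have "0 < q"
    using q[of 0] q[of g] \<open>0 < g\<close> by (intro Nat.gr0I) simp

  have A_sub: "support_rel A \<subseteq> support_rel B"
    using assms(7) unfolding A_def by (rule support_rel_mono)
  obtain M where "0 < M" and M: "\<And>v l. v \<in> V \<Longrightarrow> M \<le> l \<Longrightarrow> q dvd l \<Longrightarrow> (v, v) \<in> support_rel A ^^ l"
  proof -
    obtain M where "0 < M" and M: "\<forall>u\<in>{1..n}. \<forall>v\<in>{1..n}. \<forall>l\<ge>M.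
      [int v - int u = int l * int (Min S)] (mod int g) \<longrightarrow>
      (\<exists>p. pre_digraph.awalk (with_proj (digraph_of A)) u p v \<and> length p = l)"
      using assms(5) unfolding walk_ensured_def A_def g_def by blast
    have "(v, v) \<in> support_rel A ^^ l" if "v \<in> V" "M \<le> l" "q dvd l" for v l
    proof -
      have "int g dvd int (l * Min S)"
        unfolding int_dvd_int_iff using q that(3) by simp
      then have "[int (Suc v) - int (Suc v) = int l * int (Min S)] (mod int g)"
        by (simp add: cong_iff_dvd_diff)
      moreover have "Suc v \<in> {1..n}"
        using that(1) by (simp add: V_def Suc_le_eq)
      ultimately obtain p where "pre_digraph.awalk (with_proj (digraph_of A)) (Suc v) p (Suc v)"
        and "length p = l"
        using M \<open>M \<le> l\<close> by blast
      then show ?thesis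
        using awalk_digraph_of_imp_relpow by fastforce
    qed
    then show ?thesis
      using that \<open>0 < M\<close> by blast
  qed
  have A_closed: "q dvd l" if "(r, r) \<in> support_rel A ^^ l" for r l
  proof -
    have "int g dvd int (l * Min S)"
      using toeplitz_relpow_cong[OF assms(1) \<open>finite S\<close> assms(3) that[unfolded A_def]]
      by (simp add: cong_iff_dvd_diff g_def)
    then show ?thesis
      unfolding int_dvd_int_iff q .
  qed

  \<comment> \<open>Stated for a general \<open>C\<close> to serve both matrices: for
    \<open>A\<close> the condition on \<open>r\<close> is trivial, for \<open>B\<close> it comes
    from the source or sink.\<close>
  have period: "matrix_period C = q"
    if "C \<in> carrier_mat n n" "support_rel A \<subseteq> support_rel C" "r < n"
      "\<And>l. (r, r) \<in> support_rel C ^^ l \<Longrightarrow> (r, r) \<in> support_rel A ^^ l" for C r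
    unfolding matrix_period_eq_relpow[OF that(1)]
  proof (rule relpow_period_eq[where V = V and r = r])
    show "support_rel C \<subseteq> V \<times> V"
      using that(1) by (auto simp: support_rel_def V_def)
    show "(v, v) \<in> support_rel C ^^ l" if "v \<in> V" "M \<le> l" "q dvd l" for v l
      using M[OF that] relpow_mono_on_closed[of "support_rel A" UNIV "support_rel C"]
        \<open>support_rel A \<subseteq> support_rel C\<close> by blast
  qed (use that A_closed \<open>0 < q\<close> \<open>0 < M\<close> in \<open>auto simp: V_def\<close>)

  have diff: "support_rel (B - A) = support_rel B - support_rel A"
    by (rule support_rel_diff[OF A assms(6)])
  have A_cong: "[Suc i = Suc j] (mod d)" if "(i, j) \<in> support_rel A" for i j
    using toeplitz_arc_cong_Gcd[OF that[unfolded A_def]] cong_add_rcancel_nat[of i 1 j]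
    by (simp add: d_def)
  obtain r where "r < n"
    and r: "\<And>l. (r, r) \<in> support_rel B ^^ l \<Longrightarrow> (r, r) \<in> support_rel A ^^ l"
    using assms(8)
  proof
    assume "has_source (residue_contraction (digraph_of (B - toeplitz n S T)) (Gcd (S \<union> T)))"
    then obtain v where v: "v \<in> {1..d}"
      "\<And>m l. (m, l) \<in> parcs (digraph_of (B - A)) \<Longrightarrow> \<not> [l = v] (mod d)"
      using residue_contraction_source[OF \<open>0 < d\<close>] unfolding A_def d_def by metis
    \<comment> \<open>At a source no arc of \<open>B - A\<close> enters the class, so walks are
      followed backwards from their end, through the converse relations. \<open>Suc i\<close> is the
      vertex with matrix index \<open>i\<close>.\<close>
    define P where "P = {i. [Suc i = v] (mod d)}"
    have step: "(x, y) \<in> (support_rel A)\<inverse> \<and> y \<in> P" if "(x, y) \<in> (support_rel B)\<inverse>" "x \<in> P" for x y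
    proof -
      have "(Suc y, Suc x) \<notin> parcs (digraph_of (B - A))"
        using v(2) that(2) by (auto simp: P_def)
      then have "(y, x) \<in> support_rel A"
        using that(1) by (simp add: Suc_Suc_mem_parcs_digraph_of diff)
      then show ?thesis
        using A_cong that(2) by (auto simp: P_def intro: cong_trans)
    qed
    have "(v - 1, v - 1) \<in> support_rel A ^^ l" if "(v - 1, v - 1) \<in> support_rel B ^^ l" for l
    proof -
      have "(v - 1, v - 1) \<in> (support_rel B)\<inverse> ^^ l"
        using that by (simp add: converse_relpow)
      from relpow_mono_on_closed[OF step this] v(1) show ?thesis
        by (simp add: P_def converse_relpow)
    qed
    moreover have "v - 1 < n"
      using v(1) \<open>d < n\<close> by (intro less_imp_diff_less) simp
    ultimately show ?thesis
      using that by blast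
  next
    assume "has_sink (residue_contraction (digraph_of (B - toeplitz n S T)) (Gcd (S \<union> T)))"
    then obtain v where v: "v \<in> {1..d}"
      "\<And>m l. (m, l) \<in> parcs (digraph_of (B - A)) \<Longrightarrow> \<not> [m = v] (mod d)"
      using residue_contraction_sink[OF \<open>0 < d\<close>] unfolding A_def d_def by metis
    \<comment> \<open>At a sink no arc of \<open>B - A\<close> leaves the class, so walks are
      followed forwards.\<close>
    define P where "P = {i. [Suc i = v] (mod d)}"
    have step: "(x, y) \<in> support_rel A \<and> y \<in> P" if "(x, y) \<in> support_rel B" "x \<in> P" for x y
    proof -
      have "(Suc x, Suc y) \<notin> parcs (digraph_of (B - A))"
        using v(2) that(2) by (auto simp: P_def)
      then have "(x, y) \<in> support_rel A"
        using that(1) by (simp add: Suc_Suc_mem_parcs_digraph_of diff)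
      then show ?thesis
        using cong_trans[OF cong_sym[OF A_cong]] that(2) by (auto simp: P_def)
    qed
    have "(v - 1, v - 1) \<in> support_rel A ^^ l" if "(v - 1, v - 1) \<in> support_rel B ^^ l" for l
      using relpow_mono_on_closed[OF step that] v(1) by (simp add: P_def)
    moreover have "v - 1 < n"
      using v(1) \<open>d < n\<close> by (intro less_imp_diff_less) simp
    ultimately show ?thesis
      using that by blast
  qed
  have "matrix_period A = q"
    using period[OF A] \<open>r < n\<close> by blast
  moreover have "matrix_period B = q"
    using period[OF assms(6) A_sub \<open>r < n\<close> r] .
  ultimately show ?thesis
    by (simp add: A_def)
qed

end
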